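(* Let $0<T<T_1<T_2$ and $0<H_1<H_2<\frac12$, and for $0<s\le T$ set $$\Delta(s)=\begin{vmatrix} \bar c_{H_1}s^{H_1-\frac12}K_{H_1}\!\left(\frac{T_1}s\right) & \bar c_{H_2}s^{H_2-\frac12}K_{H_2}\!\left(\frac{T_1}s\right)\\[4pt] \bar c_{H_1}s^{H_1-\frac12}K_{H_1}\!\left(\frac{T_2}s\right) & \bar c_{H_2}s^{H_2-\frac12}K_{H_2}\!\left(\frac{T_2}s\right) \end{vmatrix}.$$ If $\Delta(T)<0$, then $\Delta(s)<0$ for all $0<s\le T$. If instead $\Delta(T)\ge0$, then there exists a unique $0<s\le T$ such that $\Delta(s)=0$.
   Context: For $H\in(0,\frac12)$ and $r>1$, $$K_H(r)=r^{H-\frac12}(r-1)^{H-\frac12}+\left(\tfrac12-H\right)\int_1^rv^{H-\frac32}(v-1)^{H-\frac12}dv,\qquad \bar c_H=\left(\frac{2H\,\Gamma(\frac32-H)}{\Gamma(H+\frac12)\Gamma(2-2H)}\right)^{\frac12}.$$ The function $(t,s)\mapsto\bar c_Hs^{H-\frac12}K_H(t/s)$, $0<s<t$, is the kernel in the representation $B^H_t=\int_0^t\bar c_Hs^{H-\frac12}K_H(t/s)\,dW_s$ of fractional Brownian motion with Hurst index $H$ ($W$ a Wiener process). *)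

theory Defs
  imports "HOL-Analysis.Analysis"
begin

text \<open>
  The integrand has an integrable singularity at \<open>v = 1\<close>, where \<open>powr\<close> takes the value \<open>0\<close>;
  this single point does not affect the integral.
\<close>

definition K :: "real \<Rightarrow> real \<Rightarrow> real" where
  "K H r = r powr (H - 1/2) * (r - 1) powr (H - 1/2)
     + (1/2 - H) * integral {1..r} (\<lambda>v. v powr (H - 3/2) * (v - 1) powr (H - 1/2))"

definition c_bar :: "real \<Rightarrow> real" where
  "c_bar H = (2 * H * Gamma (3/2 - H) / (Gamma (H + 1/2) * Gamma (2 - 2 * H))) powr (1/2)"

text \<open>
  For \<open>0 < s < t\<close>, the kernel in the representation of fractional Brownian motion with Hurst
  index \<open>H\<close> as a Wiener integral over \<open>[0, t]\<close>.
\<close>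

definition fbm_kernel :: "real \<Rightarrow> real \<Rightarrow> real \<Rightarrow> real" where
  "fbm_kernel H t s = c_bar H * s powr (H - 1/2) * K H (t / s)"

definition Delta :: "real \<Rightarrow> real \<Rightarrow> real \<Rightarrow> real \<Rightarrow> real \<Rightarrow> real" where
  "Delta H1 H2 T1 T2 s =
     det (vector [vector [fbm_kernel H1 T1 s, fbm_kernel H2 T1 s],
                  vector [fbm_kernel H1 T2 s, fbm_kernel H2 T2 s]] :: real^2^2)"

end

theory Submission
  imports Defs
begin

text \<open>
  Up to a positive factor, \<open>\<Delta>(s)\<close> is \<open>g (k * x) - g x\<close> with \<open>g = K H2 / K H1\<close>, \<open>x = T1/s\<close> and
  \<open>k = T2/T1\<close>. The derivative of \<open>K H\<close> collapses to the single term
  \<open>-(1/2 - H) r^(H - 1/2) (r - 1)^(H - 3/2)\<close>, so the quotient \<open>q\<close> of the derivatives of \<open>K H2\<close> and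
  \<open>K H1\<close> is strictly increasing and unbounded, and \<open>g'\<close> has the sign of \<open>\<phi> = K H2 - q * K H1\<close>.
  Since \<open>\<phi>' = - q' * K H1 < 0\<close>, the function \<open>g\<close> is unimodal and finally decreasing; hence
  \<open>g (k * x) - g x\<close> is negative for large \<open>x\<close>, and once it is nonnegative at some \<open>y\<close> it is positive
  at all \<open>x < y\<close>.
\<close>

section \<open>Dilations of a unimodal function\<close>

text \<open>With a positive weight \<open>p\<close> split off, the sign of the derivative of
  \<open>g\<close> is that of the strictly decreasing \<open>\<phi>\<close>, so it can change only
  once, from plus to minus. The bound \<open>0 \<le> a\<close> ensures that a dilation by a factor
  above \<open>1\<close> moves points to the right.\<close>

locale unimodal_derivative =
  fixes g p \<phi> :: "real \<Rightarrow> real" and a :: real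
  assumes deriv: "a < x \<Longrightarrow> (g has_real_derivative p x * \<phi> x) (at x)"
    and weight_pos: "a < x \<Longrightarrow> 0 < p x"
    and sign_decreasing: "\<lbrakk>a < x; x < y\<rbrakk> \<Longrightarrow> \<phi> y < \<phi> x"
    and nonneg: "0 \<le> a"
begin

lemma continuous: "continuous_on {a<..} g"
  by (meson DERIV_isCont continuous_at_imp_continuous_on deriv greaterThan_iff)

text \<open>Strict decrease of \<open>\<phi>\<close> makes it positive everywhere left of
  \<open>y\<close>, and the open-interval derivative test never looks at \<open>y\<close> itself, so
  \<open>\<phi> y = 0\<close> is allowed.\<close>

lemma increasing:
  assumes "a < x" "x < y" "0 \<le> \<phi> y"
  shows "g x < g y"
proof (rule DERIV_pos_imp_increasing_open[OF \<open>x < y\<close>])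
  show "\<exists>d. (g has_real_derivative d) (at z) \<and> 0 < d" if "x < z" "z < y" for z
  proof -
    have "0 < \<phi> z" using sign_decreasing[of z y] assms that by linarith
    then show ?thesis using deriv[of z] weight_pos[of z] assms that
      by (intro exI[of _ "p z * \<phi> z"]) auto
  qed
  show "continuous_on {x..y} g"
    using assms by (intro continuous_on_subset[OF continuous]) auto
qed

lemma decreasing:
  assumes "a < x" "x < y" "\<phi> x \<le> 0"
  shows "g y < g x"
proof (rule DERIV_neg_imp_decreasing_open[OF \<open>x < y\<close>])
  show "\<exists>d. (g has_real_derivative d) (at z) \<and> d < 0" if "x < z" "z < y" for z
  proof -
    have "\<phi> z < 0" using sign_decreasing[of x z] assms that by linarith
    then show ?thesis using deriv[of z] weight_pos[of z] assms that
      by (intro exI[of _ "p z * \<phi> z"]) (auto simp: mult_pos_neg)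
  qed
  show "continuous_on {x..y} g"
    using assms by (intro continuous_on_subset[OF continuous]) auto
qed

text \<open>The hypothesis on \<open>y\<close> forces \<open>0 < \<phi> y\<close>, since otherwise
  \<open>g\<close> would fall from \<open>y\<close> on. If \<open>\<phi>\<close> is still
  nonnegative at \<open>k * x\<close>, then \<open>g\<close> rises on all of
  \<open>[x, k * x]\<close>. Otherwise \<open>g\<close> rises from \<open>x\<close> to
  \<open>y\<close> and falls from \<open>k * x\<close> to \<open>k * y\<close>, so moving from
  \<open>y\<close> down to \<open>x\<close> widens the difference.\<close>

lemma dilation_increase_downward:
  assumes "1 < k" "a < x" "x < y" and inc: "g y \<le> g (k * y)"
  shows "g x < g (k * x)"
proof -
  have less: "z < k * z" if "a < z" for z
    using that nonneg \<open>1 < k\<close> by simp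
  have y: "a < y" using assms by simp
  have "0 < \<phi> y" using decreasing[OF y less[OF y]] inc by linarith
  show ?thesis
  proof (cases "0 \<le> \<phi> (k * x)")
    case True
    then show ?thesis using increasing[OF \<open>a < x\<close> less[OF \<open>a < x\<close>]] by simp
  next
    case False
    have "g x < g y" using increasing assms \<open>0 < \<phi> y\<close> by simp
    moreover have "g (k * y) < g (k * x)"
      using False assms less[OF \<open>a < x\<close>] by (intro decreasing) auto
    ultimately show ?thesis using inc by linarith
  qed
qed

lemma dilation_zero_ex1:
  assumes "1 < k" "a < b" and inc: "g b \<le> g (k * b)" and ev: "\<exists>X>a. \<phi> X \<le> 0"
  shows "\<exists>!x. b \<le> x \<and> g (k * x) = g x"
proof -
  obtain X where X: "a < X" "\<phi> X \<le> 0" using ev by blast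
  \<comment> \<open>Right of both \<open>b\<close> and a point with \<open>\<phi> \<le> 0\<close>,
    \<open>g\<close> only falls; hence the difference is negative at \<open>Y\<close> and the
    intermediate value theorem applies on \<open>[b, Y]\<close>.\<close>
  define Y where "Y = max X b"
  have less: "z < k * z" if "a < z" for z
    using that nonneg \<open>1 < k\<close> by simp
  have "\<phi> Y \<le> 0" "b \<le> Y" "a < Y"
    using X sign_decreasing[of X b] by (cases "X < b"; cases "X = b"; simp add: Y_def)+
  have "g (k * Y) < g Y"
    by (rule decreasing) (use \<open>\<phi> Y \<le> 0\<close> \<open>a < Y\<close> less in auto)
  have "continuous_on {b..Y} (\<lambda>x. g (k * x) - g x)"
  proof (rule continuous_on_diff)
    have "k * z \<in> {a<..}" if "z \<in> {b..Y}" for z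
      using less[of z] that \<open>a < b\<close> by auto
    then show "continuous_on {b..Y} (\<lambda>x. g (k * x))"
      by (intro continuous_on_compose2[OF continuous, of _ "\<lambda>x. k * x"] continuous_on_mult_left
          continuous_on_id image_subsetI)
    show "continuous_on {b..Y} g"
      using \<open>a < b\<close> by (intro continuous_on_subset[OF continuous]) auto
  qed
  then obtain x where "b \<le> x" "g (k * x) - g x = 0"
    using IVT2'[of "\<lambda>x. g (k * x) - g x" Y 0 b] inc \<open>g (k * Y) < g Y\<close> \<open>b \<le> Y\<close> by auto
  \<comment> \<open>Of two zeros, the smaller would have a strictly positive difference by
    \<open>dilation_increase_downward\<close>.\<close>
  then show ?thesis
    using dilation_increase_downward[OF \<open>1 < k\<close>] \<open>a < b\<close>
    by (intro ex1I[of _ x]) (auto, metis less_irrefl linorder_neqE_linordered_idom order_less_le_trans order_refl)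
qed

end

section \<open>The kernel\<close>

lemma K_integrand_integrable:
  fixes H r :: real
  assumes "0 < H" "H < 1/2" "1 \<le> r"
  shows "(\<lambda>v. v powr (H - 3/2) * (v - 1) powr (H - 1/2)) integrable_on {1..r}"
proof (rule measurable_bounded_by_integrable_imp_integrable)
  \<comment> \<open>For \<open>v \<ge> 1\<close> the factor \<open>v powr (H - 3/2)\<close> is at
    most \<open>1\<close>, so the singular factor alone dominates. Its antiderivative is continuous
    at \<open>v = 1\<close> because \<open>H + 1/2 > 0\<close>.\<close>
  have "((\<lambda>v. (v - 1) powr (H - 1/2)) has_integral
          (r - 1) powr (H + 1/2) / (H + 1/2) - (1 - 1) powr (H + 1/2) / (H + 1/2)) {1..r}"
  proof (rule fundamental_theorem_of_calculus_interior)
    show "continuous_on {1..r} (\<lambda>v. (v - 1) powr (H + 1/2) / (H + 1/2))"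
      using assms by (intro continuous_intros continuous_on_powr') auto
    show "((\<lambda>v. (v - 1) powr (H + 1/2) / (H + 1/2)) has_vector_derivative
            (v - 1) powr (H - 1/2)) (at v)" if "v \<in> {1<..<r}" for v
      unfolding has_real_derivative_iff_has_vector_derivative[symmetric]
      using assms that by (auto intro!: derivative_eq_intros simp flip: diff_diff_eq)
  qed (use assms in auto)
  then show "(\<lambda>v. (v - 1) powr (H - 1/2)) integrable_on {1..r}" by blast
  show "(\<lambda>v. v powr (H - 3/2) * (v - 1) powr (H - 1/2)) \<in> borel_measurable (lebesgue_on {1..r})"
    by (intro measurable_restrict_space1 borel_measurable_times measurable_completion) measurable
  show "norm (v powr (H - 3/2) * (v - 1) powr (H - 1/2)) \<le> (v - 1) powr (H - 1/2)"
    if "v \<in> {1..r}" for v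
    using that assms powr_mono[of "H - 3/2" 0 v] by (auto intro!: mult_left_le_one_le)
qed auto

text \<open>The integrand is discontinuous at \<open>1\<close>, so the integral is split at a
  midpoint \<open>c\<close> between \<open>1\<close> and \<open>r\<close>: the part up to
  \<open>c\<close> is constant, and the rest has a continuous integrand.\<close>

lemma K_integral_has_derivative:
  fixes H r :: real
  assumes "0 < H" "H < 1/2" "1 < r"
  defines "f \<equiv> \<lambda>v. v powr (H - 3/2) * (v - 1) powr (H - 1/2)"
  shows "((\<lambda>r. integral {1..r} f) has_real_derivative f r) (at r)"
proof -
  define c where "c = (1 + r) / 2"
  have c: "1 < c" "c < r" using assms by (auto simp: c_def)
  have "((\<lambda>x. integral {c..x} f) has_real_derivative f r) (at r within {c..r+1})"
    unfolding f_def using c by (intro integral_has_real_derivative continuous_intros) auto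
  moreover have "r \<in> interior {c..r+1}" using c by simp
  ultimately have "((\<lambda>x. integral {c..x} f) has_real_derivative f r) (at r)"
    by (metis at_within_interior)
  then have "((\<lambda>x. integral {1..c} f + integral {c..x} f) has_real_derivative f r) (at r)"
    by (auto intro!: derivative_eq_intros)
  then show ?thesis
  proof (rule has_field_derivative_transform_within_open[of _ _ _ "{c<..}"])
    show "integral {1..c} f + integral {c..x} f = integral {1..x} f" if "x \<in> {c<..}" for x
      using that c assms K_integrand_integrable[of H x]
      by (intro Henstock_Kurzweil_Integration.integral_combine) auto
  qed (use c in auto)
qed

lemma K_integral_mono:
  fixes H :: real
  assumes "0 < H" "H < 1/2" "1 \<le> r" "r \<le> s"
  shows "integral {1..r} (\<lambda>v. v powr (H - 3/2) * (v - 1) powr (H - 1/2))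
    \<le> integral {1..s} (\<lambda>v. v powr (H - 3/2) * (v - 1) powr (H - 1/2))"
  using assms by (intro integral_subset_le K_integrand_integrable) auto

text \<open>The integral is nonnegative up to a midpoint \<open>c > 1\<close>, and from there on its
  derivative is positive.\<close>

lemma K_integral_pos:
  fixes H r :: real
  assumes "0 < H" "H < 1/2" "1 < r"
  shows "0 < integral {1..r} (\<lambda>v. v powr (H - 3/2) * (v - 1) powr (H - 1/2))"
proof -
  let ?f = "\<lambda>v. v powr (H - 3/2) * (v - 1) powr (H - 1/2)"
  define c where "c = (1 + r) / 2"
  have c: "1 < c" "c < r" using assms by (auto simp: c_def)
  have "0 \<le> integral {1..c} ?f"
    using assms c by (intro integral_nonneg K_integrand_integrable) auto
  also have "\<dots> < integral {1..r} ?f"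
  proof (rule DERIV_pos_imp_increasing[OF \<open>c < r\<close>])
    show "\<exists>y. ((\<lambda>r. integral {1..r} ?f) has_real_derivative y) (at x) \<and> 0 < y"
      if "c \<le> x" "x \<le> r" for x
      by (rule exI, rule conjI, rule K_integral_has_derivative) (use assms c that in auto)
  qed
  finally show ?thesis .
qed

section \<open>Bounds and derivative of \<open>K\<close>\<close>

lemma K_lower_bound:
  fixes H :: real
  assumes "0 < H" "H < 1/2"
  obtains m where "0 < m" "\<And>r. 2 \<le> r \<Longrightarrow> m \<le> K H r"
proof
  \<comment> \<open>The product of powers in \<open>K\<close> is nonnegative and the integral grows
    with \<open>r\<close>, so the integral term at \<open>2\<close> serves as the bound.\<close>
  let ?J = "\<lambda>r. integral {1..r} (\<lambda>v. v powr (H - 3/2) * (v - 1) powr (H - 1/2))"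
  show "0 < (1/2 - H) * ?J 2"
    using K_integral_pos[of H 2] assms by simp
  show "(1/2 - H) * ?J 2 \<le> K H r" if "2 \<le> r" for r
  proof -
    have "(1/2 - H) * ?J 2 \<le> (1/2 - H) * ?J r"
      using assms that by (intro mult_left_mono K_integral_mono) auto
    then show ?thesis by (simp add: K_def add_increasing)
  qed
qed

lemma K_pos:
  fixes H r :: real
  assumes "0 < H" "H < 1/2" "1 < r"
  shows "0 < K H r"
  using K_integral_pos[of H r] assms by (simp add: K_def add_pos_pos)

text \<open>The derivative of the integral cancels the part of the product rule that differentiates
  \<open>r powr (H - 1/2)\<close>.\<close>

lemma K_has_derivative:
  fixes H r :: real
  assumes "0 < H" "H < 1/2" "1 < r"
  shows "(K H has_real_derivative - ((1/2 - H) * r powr (H - 1/2) * (r - 1) powr (H - 3/2))) (at r)"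
proof -
  have *: "((\<lambda>r. r powr (H - 1/2)) has_real_derivative (H - 1/2) * r powr (H - 3/2)) (at r)"
    "((\<lambda>r. (r - 1) powr (H - 1/2)) has_real_derivative (H - 1/2) * (r - 1) powr (H - 3/2)) (at r)"
    using assms by (auto intro!: derivative_eq_intros)
  show ?thesis
    unfolding K_def[abs_def]
    by (rule DERIV_cong[OF DERIV_add[OF DERIV_mult[OF *]
            DERIV_cmult[OF K_integral_has_derivative[OF assms]]]])
      (simp add: algebra_simps)
qed

lemma K_antimono:
  fixes H :: real
  assumes "0 < H" "H < 1/2" "1 < r" "r \<le> s"
  shows "K H s \<le> K H r"
proof (rule DERIV_nonpos_imp_nonincreasing[OF \<open>r \<le> s\<close>])
  show "\<exists>d. (K H has_real_derivative d) (at x) \<and> d \<le> 0" if "r \<le> x" "x \<le> s" for x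
    by (rule exI, rule conjI, rule K_has_derivative) (use assms that in auto)
qed

section \<open>Sign of the derivative of \<open>K H2 / K H1\<close>\<close>

definition K_deriv_quotient :: "real \<Rightarrow> real \<Rightarrow> real \<Rightarrow> real" where
  "K_deriv_quotient H1 H2 r =
     (1/2 - H2) / (1/2 - H1) * (r powr (H2 - H1) * (r - 1) powr (H2 - H1))"

context
  fixes H1 H2 :: real
  assumes H: "0 < H1" "H1 < H2" "H2 < 1/2"
begin

lemma K_deriv_quotient_has_pos_derivative:
  assumes "1 < r"
  shows "\<exists>d>0. (K_deriv_quotient H1 H2 has_real_derivative d) (at r)"
proof -
  let ?d = "(1/2 - H2) / (1/2 - H1) *
    ((H2 - H1) * r powr (H2 - H1 - 1) * (r - 1) powr (H2 - H1)
     + r powr (H2 - H1) * ((H2 - H1) * (r - 1) powr (H2 - H1 - 1)))"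
  have "0 < ?d" using H assms by (intro mult_pos_pos add_pos_pos divide_pos_pos) auto
  moreover have "(K_deriv_quotient H1 H2 has_real_derivative ?d) (at r)"
  proof -
    have "((\<lambda>r. r powr (H2 - H1)) has_real_derivative (H2 - H1) * r powr (H2 - H1 - 1)) (at r)"
      "((\<lambda>r. (r - 1) powr (H2 - H1)) has_real_derivative (H2 - H1) * (r - 1) powr (H2 - H1 - 1)) (at r)"
      using assms by (auto intro!: derivative_eq_intros)
    then show ?thesis
      unfolding K_deriv_quotient_def[abs_def]
      by (rule DERIV_cong[OF DERIV_cmult[OF DERIV_mult]]) (simp add: algebra_simps)
  qed
  ultimately show ?thesis by blast
qed

text \<open>In this form the terms with the derivatives of \<open>K H1\<close> and
  \<open>K H2\<close> cancel when \<open>K H2 - q * K H1\<close> is differentiated, \<open>q\<close>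
  being the quotient, and \<open>- q' * K H1\<close> remains.\<close>

lemma K_H2_derivative:
  assumes "1 < r"
  shows "(K H2 has_real_derivative K_deriv_quotient H1 H2 r *
    - ((1/2 - H1) * r powr (H1 - 1/2) * (r - 1) powr (H1 - 3/2))) (at r)"
proof -
  have "r powr (H2 - 1/2) = r powr (H2 - H1) * r powr (H1 - 1/2)"
    and "(r - 1) powr (H2 - 3/2) = (r - 1) powr (H2 - H1) * (r - 1) powr (H1 - 3/2)"
    by (simp_all add: powr_add[symmetric])
  then show ?thesis
    using K_has_derivative[of H2 r] H assms
    by (simp add: K_deriv_quotient_def mult_ac)
qed

lemma K_ratio_sign_decreasing:
  assumes "1 < r" "r < s"
  shows "K H2 s - K_deriv_quotient H1 H2 s * K H1 s < K H2 r - K_deriv_quotient H1 H2 r * K H1 r"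
proof (rule DERIV_neg_imp_decreasing[OF \<open>r < s\<close>])
  fix x assume "r \<le> x" "x \<le> s"
  then have x: "1 < x" using assms by simp
  obtain d where d: "0 < d" "(K_deriv_quotient H1 H2 has_real_derivative d) (at x)"
    using K_deriv_quotient_has_pos_derivative[OF x] by blast
  have "((\<lambda>x. K H2 x - K_deriv_quotient H1 H2 x * K H1 x) has_real_derivative - (d * K H1 x)) (at x)"
    by (rule DERIV_cong[OF DERIV_diff[OF K_H2_derivative[OF x]
            DERIV_mult[OF d(2) K_has_derivative[OF _ _ x]]]]) (use H in auto)
  then show "\<exists>y. ((\<lambda>x. K H2 x - K_deriv_quotient H1 H2 x * K H1 x) has_real_derivative y) (at x) \<and> y < 0"
    using d K_pos[of H1 x] H x by (intro exI conjI) auto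
qed

lemma K_ratio_sign_eventually_neg:
  "\<exists>r>1. K H2 r - K_deriv_quotient H1 H2 r * K H1 r \<le> 0"
proof -
  obtain m where m: "0 < m" "\<And>r. 2 \<le> r \<Longrightarrow> m \<le> K H1 r"
    using K_lower_bound[of H1] H by auto
  define \<kappa> where "\<kappa> = (1/2 - H2) / (1/2 - H1)"
  \<comment> \<open>Chosen to solve \<open>\<kappa> * y powr (H2 - H1) * m = K H2 2\<close>. At
    \<open>r = 2 + y\<close> the quotient is at least \<open>\<kappa> * y powr (H2 - H1)\<close>,
    because \<open>r \<ge> 1\<close> and \<open>r - 1 \<ge> y\<close>.\<close>
  define y where "y = (K H2 2 / (\<kappa> * m)) powr (1 / (H2 - H1))"
  define r where "r = 2 + y"
  have \<kappa>: "0 < \<kappa>" using H by (simp add: \<kappa>_def)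
  have K2: "0 < K H2 2" using H by (intro K_pos) auto
  have y: "0 < y" using \<kappa> m K2 by (simp add: y_def)
  have "K H2 r \<le> K H2 2" using H y by (intro K_antimono) (auto simp: r_def)
  also have "\<dots> = \<kappa> * (1 * y powr (H2 - H1)) * m"
    using \<kappa> m K2 H by (simp add: y_def powr_powr)
  also have "\<dots> \<le> K_deriv_quotient H1 H2 r * K H1 r"
    unfolding K_deriv_quotient_def \<kappa>_def[symmetric]
    using \<kappa> m H y by (intro mult_mono mult_left_mono powr_mono2 ge_one_powr_ge_zero)
      (auto simp: r_def)
  finally show ?thesis using y by (intro exI[of _ r]) (auto simp: r_def)
qed

text \<open>The quotient rule with the derivative of \<open>K H2\<close> written as a multiple of
  that of \<open>K H1\<close>; the weight is minus the derivative of \<open>K H1\<close> over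
  \<open>(K H1 r)\<^sup>2\<close>.\<close>

lemma K_ratio_unimodal:
  "unimodal_derivative (\<lambda>r. K H2 r / K H1 r)
     (\<lambda>r. (1/2 - H1) * r powr (H1 - 1/2) * (r - 1) powr (H1 - 3/2) / (K H1 r)\<^sup>2)
     (\<lambda>r. K H2 r - K_deriv_quotient H1 H2 r * K H1 r) 1"
proof
  fix x :: real assume x: "1 < x"
  have pos: "0 < K H1 x" using K_pos H x by simp
  show "0 < (1/2 - H1) * x powr (H1 - 1/2) * (x - 1) powr (H1 - 3/2) / (K H1 x)\<^sup>2"
    using pos H x by simp
  show "((\<lambda>r. K H2 r / K H1 r) has_real_derivative
      (1/2 - H1) * x powr (H1 - 1/2) * (x - 1) powr (H1 - 3/2) / (K H1 x)\<^sup>2 *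
      (K H2 x - K_deriv_quotient H1 H2 x * K H1 x)) (at x)"
    by (rule DERIV_cong[OF DERIV_divide[OF K_H2_derivative[OF x] K_has_derivative[OF _ _ x]]])
      (use pos H in \<open>auto simp: power2_eq_square field_simps\<close>)
qed (use K_ratio_sign_decreasing in auto)

end

section \<open>The determinant\<close>

lemma c_bar_pos:
  assumes "0 < H" "H < 1/2"
  shows "0 < c_bar H"
proof -
  have "Gamma (3/2 - H) > 0" "Gamma (H + 1/2) > 0" "Gamma (2 - 2 * H) > 0"
    using assms by (auto intro!: Gamma_real_pos)
  then have "0 < 2 * H * Gamma (3/2 - H) / (Gamma (H + 1/2) * Gamma (2 - 2 * H))"
    using assms by (intro divide_pos_pos mult_pos_pos) auto
  then show ?thesis unfolding c_bar_def by (subst powr_gt_zero) linarith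
qed

text \<open>The constants and powers of \<open>s\<close> factor out of the columns, and dividing by
  both values of \<open>K H1\<close> turns the determinant into a difference of ratios. Only the
  sign of \<open>C\<close> matters later.\<close>

lemma Delta_eq:
  fixes T1 T2 H1 H2 :: real
  assumes "0 < s" "s < T1" "T1 < T2" "0 < H1" "H1 < 1/2" "0 < H2" "H2 < 1/2"
  obtains C where "0 < C" and "Delta H1 H2 T1 T2 s =
    C * (K H2 (T2/T1 * (T1/s)) / K H1 (T2/T1 * (T1/s)) - K H2 (T1/s) / K H1 (T1/s))"
proof
  have eq: "T2/T1 * (T1/s) = T2/s" using assms by simp
  have pos: "0 < K H1 (T1/s)" "0 < K H1 (T2/s)"
    using assms by (auto intro!: K_pos)
  show "0 < c_bar H1 * c_bar H2 * s powr (H1 - 1/2) * s powr (H2 - 1/2) * K H1 (T1/s) * K H1 (T2/s)"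
    using pos c_bar_pos assms by simp
  show "Delta H1 H2 T1 T2 s =
    c_bar H1 * c_bar H2 * s powr (H1 - 1/2) * s powr (H2 - 1/2) * K H1 (T1/s) * K H1 (T2/s) *
    (K H2 (T2/T1 * (T1/s)) / K H1 (T2/T1 * (T1/s)) - K H2 (T1/s) / K H1 (T1/s))"
    unfolding eq using pos by (simp add: Delta_def det_2 fbm_kernel_def field_simps)
qed

theorem proposition20:
  fixes T T1 T2 H1 H2 :: real
  assumes "0 < T" and "T < T1" and "T1 < T2"
    and "0 < H1" and "H1 < H2" and "H2 < 1/2"
  shows "(Delta H1 H2 T1 T2 T < 0 \<longrightarrow> (\<forall>s. 0 < s \<and> s \<le> T \<longrightarrow> Delta H1 H2 T1 T2 s < 0)) \<and>
         (Delta H1 H2 T1 T2 T \<ge> 0 \<longrightarrow> (\<exists>!s. 0 < s \<and> s \<le> T \<and> Delta H1 H2 T1 T2 s = 0))"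
proof (intro conjI impI allI)
  define g where "g = (\<lambda>r. K H2 r / K H1 r)"
  define k where "k = T2 / T1"
  interpret unimodal_derivative g
    "\<lambda>r. (1/2 - H1) * r powr (H1 - 1/2) * (r - 1) powr (H1 - 3/2) / (K H1 r)\<^sup>2"
    "\<lambda>r. K H2 r - K_deriv_quotient H1 H2 r * K H1 r" 1
    unfolding g_def using K_ratio_unimodal assms by blast
  have k: "1 < k" using assms by (simp add: k_def)
  have sgn: "sgn (Delta H1 H2 T1 T2 s) = sgn (g (k * (T1/s)) - g (T1/s))" if "0 < s" "s \<le> T" for s
    by (rule Delta_eq[of s T1 T2 H1 H2])
      (use that assms in \<open>auto simp: g_def k_def sgn_mult\<close>)
  have neg_iff: "Delta H1 H2 T1 T2 s < 0 \<longleftrightarrow> g (k * (T1/s)) < g (T1/s)"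
    and zero_iff: "Delta H1 H2 T1 T2 s = 0 \<longleftrightarrow> g (k * (T1/s)) = g (T1/s)" if "0 < s" "s \<le> T" for s
    using sgn[OF that] by (auto simp: sgn_if split: if_splits)
  {
    fix s assume neg: "Delta H1 H2 T1 T2 T < 0" and s: "0 < s \<and> s \<le> T"
    show "Delta H1 H2 T1 T2 s < 0"
    proof (rule ccontr)
      assume nn: "\<not> Delta H1 H2 T1 T2 s < 0"
      then have "s < T" using neg s by (cases "s = T") auto
      \<comment> \<open>Passing from \<open>s\<close> to \<open>T1/s\<close> reverses the order:
        \<open>s < T\<close> gives \<open>T1/T < T1/s\<close>, so a nonnegative difference at
        \<open>T1/s\<close> would make the one at \<open>T1/T\<close> positive.\<close>
      then have "g (T1/T) < g (k * (T1/T))"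
        using nn neg_iff[of s] s assms
        by (intro dilation_increase_downward[of _ _ "T1/s"] k) (auto simp: divide_strict_left_mono)
      then show False using neg_iff[of T] neg assms by simp
    qed
  next
    assume "Delta H1 H2 T1 T2 T \<ge> 0"
    \<comment> \<open>The range \<open>0 < s \<le> T\<close> corresponds to
      \<open>x \<ge> T1/T\<close> under \<open>x = T1/s\<close>.\<close>
    then have "\<exists>!x. T1/T \<le> x \<and> g (k * x) = g x"
      using neg_iff[of T] assms k K_ratio_sign_eventually_neg[of H1 H2]
      by (intro dilation_zero_ex1) auto
    then obtain x where x: "T1/T \<le> x" "g (k * x) = g x"
      and unique: "\<And>y. T1/T \<le> y \<Longrightarrow> g (k * y) = g y \<Longrightarrow> y = x" by blast
    have "0 < T1/T" using assms by simp
    then have "0 < x" using x by linarith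
    show "\<exists>!s. 0 < s \<and> s \<le> T \<and> Delta H1 H2 T1 T2 s = 0"
    proof (rule ex1I[of _ "T1/x"])
      have s: "0 < T1/x" "T1/x \<le> T" using x \<open>0 < x\<close> assms by (auto simp: field_simps)
      then show "0 < T1/x \<and> T1/x \<le> T \<and> Delta H1 H2 T1 T2 (T1/x) = 0"
        using zero_iff[OF s] x assms by simp
      show "s = T1/x" if "0 < s \<and> s \<le> T \<and> Delta H1 H2 T1 T2 s = 0" for s
        using unique[of "T1/s"] zero_iff[of s] that assms by (auto simp: divide_left_mono)
    qed
  }
qed

end
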